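(* Let $H$ be a separable Hilbert space and let $S(\cdot,\cdot)$ be a continuous symmetric bilinear form on $H$, with induced linear map $\mathcal{S}:H\to H^\ast$, $(\mathcal{S}u)(v)=S(u,v)$. Suppose that $u_1,\dots,u_n\in H$ and $\phi_1,\dots,\phi_n\in H^\ast$ satisfy $\mathcal{S}(u_i)=\phi_i$ for $i=1,\dots,n$, and that $\{\phi_i\}_{i=1}^n$ are linearly independent. Then \[ n^{\phi_1,\dots,\phi_n}(S)=n(S)+c, \] where $c$ is the dimension of the null space of the symmetric $n\times n$ matrix $\bigl(S(u_i,u_j)\bigr)_{i,j}$.
   Context: Hilbert spaces are real; $H^\ast$ is the continuous dual of $H$. For a vector space $V$, the nullity $n(S,V)\in\{0,1,2,\dots\}\cup\{\infty\}$ is the dimension of the radical of $S$ on $V$, i.e. of $\{u\in V: S(u,v)=0\ \forall v\in V\}$. $n(S)=n(S,H)$ and $n^{\phi_1,\dots,\phi_n}(S)=n\bigl(S,\bigcap_{i=1}^n\mathrm{Ker}(\phi_i)\bigr)$. Convention: $\infty+c=\infty$. *)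

theory Defs
  imports "HOL-Analysis.Analysis" "HOL-Library.Extended_Nat"
begin

text \<open>The library's \<^const>\<open>dim\<close> is 0 on sets that are not spanned by a finite set;
  here such sets get dimension \<open>\<infinity>\<close>.\<close>

definition edim :: "'a::real_vector set \<Rightarrow> enat" where
  "edim V = (if \<exists>B. finite B \<and> V \<subseteq> span B then enat (dim V) else \<infinity>)"

definition radical_on :: "('a::real_vector \<Rightarrow> 'a \<Rightarrow> real) \<Rightarrow> 'a set \<Rightarrow> 'a set" where
  "radical_on S V = {u \<in> V. \<forall>v\<in>V. S u v = 0}"

definition nullity_on :: "('a::real_vector \<Rightarrow> 'a \<Rightarrow> real) \<Rightarrow> 'a set \<Rightarrow> enat" where
  "nullity_on S V = edim (radical_on S V)"

definition continuous_symmetric_bilinear_form :: "('a::real_normed_vector \<Rightarrow> 'a \<Rightarrow> real) \<Rightarrow> bool" where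
  "continuous_symmetric_bilinear_form S \<longleftrightarrow>
     bilinear S \<and> (\<forall>u v. S u v = S v u) \<and> continuous_on UNIV (\<lambda>(u, v). S u v)"

text \<open>The map \<open>H \<rightarrow> H\<^sup>*\<close> induced by \<open>S\<close>, with \<^typ>\<open>'a \<Rightarrow>\<^sub>L real\<close> as the continuous dual.
  \<open>Blinfun\<close> is only meaningful on bounded linear functions; see \<open>induced_map_apply\<close>.\<close>

definition induced_map :: "('a::real_normed_vector \<Rightarrow> 'a \<Rightarrow> real) \<Rightarrow> 'a \<Rightarrow> ('a \<Rightarrow>\<^sub>L real)" where
  "induced_map S u = Blinfun (S u)"

definition Ker :: "('a::real_normed_vector \<Rightarrow>\<^sub>L real) \<Rightarrow> 'a set" where
  "Ker \<phi> = {v. blinfun_apply \<phi> v = 0}"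

lemma continuous_linear_imp_bounded_linear:
  fixes f :: "'a::real_normed_vector \<Rightarrow> 'b::real_normed_vector"
  assumes "linear f" "continuous_on UNIV f"
  shows "bounded_linear f"
proof -
  have "isCont f 0"
    using assms(2) by (simp add: continuous_on_eq_continuous_at)
  then obtain d where d: "d > 0" "\<And>x. norm x < d \<Longrightarrow> norm (f x) < 1"
    using assms(1) unfolding continuous_at_eps_delta
    by (metis diff_zero dist_norm linear_0 zero_less_one)
  have "norm (f x) \<le> norm x * (2 / d)" for x
  proof (cases "x = 0")
    case True
    then show ?thesis using assms(1) by (simp add: linear_0)
  next
    case False
    let ?c = "d / (2 * norm x)"
    have "norm (?c *\<^sub>R x) < d"
      using False d(1) by simp
    then have "norm (f (?c *\<^sub>R x)) < 1"
      by (rule d(2))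
    then have "?c * norm (f x) < 1"
      using assms(1) d(1) by (simp add: linear_scale)
    then show ?thesis
      using False d(1) by (simp add: field_simps)
  qed
  then show ?thesis
    using assms(1) unfolding bounded_linear_def bounded_linear_axioms_def by blast
qed

lemma induced_map_apply:
  assumes "continuous_symmetric_bilinear_form S"
  shows "blinfun_apply (induced_map S u) v = S u v"
proof -
  have "linear (S u)"
    using assms by (simp add: continuous_symmetric_bilinear_form_def bilinear_def)
  moreover have "continuous_on UNIV ((\<lambda>(u, v). S u v) \<circ> Pair u)"
    using assms unfolding continuous_symmetric_bilinear_form_def
    by (intro continuous_on_compose) (auto intro!: continuous_intros intro: continuous_on_subset)
  then have "continuous_on UNIV (S u)"
    by (simp add: comp_def)
  ultimately show ?thesis
    by (simp add: induced_map_def bounded_linear_Blinfun_apply continuous_linear_imp_bounded_linear)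
qed

end

theory Submission
  imports Defs
begin

text \<open>A vector \<open>w\<close> lies in the radical of \<open>S\<close> on \<open>K = \<Inter>i. Ker (\<phi> i)\<close> only if \<open>S w\<close>
  vanishes on \<open>K\<close>, hence \<open>S w\<close> is a combination \<open>\<Sum>i. x\<^sub>i \<phi>\<^sub>i\<close>, that is, \<open>w - \<Sum>i. x\<^sub>i u\<^sub>i\<close> lies in
  the radical of \<open>S\<close>. The condition \<open>w \<in> K\<close> then says that \<open>x\<close> is in the null space of the matrix
  \<open>S(u\<^sub>i, u\<^sub>j)\<close>. So the radical on \<open>K\<close> is the sum of the full radical and the image of that
  null space, and the sum is direct because the \<open>\<phi>\<^sub>i\<close> are independent.\<close>

text \<open>Purely algebraic, by induction on \<open>I\<close>: subtracting a suitable multiple of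
  \<open>f a\<close> from \<open>g\<close> gives a functional that vanishes on the common kernel of
  the remaining \<open>f i\<close>.\<close>

lemma linear_functional_combination:
  fixes f :: "'i \<Rightarrow> 'a::real_vector \<Rightarrow> real"
  assumes "finite I" "\<And>i. i \<in> I \<Longrightarrow> linear (f i)" "linear g"
    and "\<And>x. (\<forall>i\<in>I. f i x = 0) \<Longrightarrow> g x = 0"
  shows "\<exists>c. \<forall>x. g x = (\<Sum>i\<in>I. c i * f i x)"
  using assms
proof (induction I arbitrary: g rule: finite_induct)
  case empty
  then show ?case by simp
next
  case (insert a I)
  have lin: "linear (f i)" if "i \<in> insert a I" for i
    using insert.prems that by blast
  \<comment> \<open>If some \<open>e\<close> in the common kernel over \<open>I\<close> has
    \<open>f a e \<noteq> 0\<close>, then \<open>k = g e / f a e\<close> works, because moving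
    \<open>x\<close> along \<open>e\<close> reaches the kernel of \<open>f a\<close> as well.
    Otherwise \<open>f a\<close> already vanishes there and \<open>k = 0\<close> will do.\<close>
  obtain k where k: "\<And>x. (\<forall>i\<in>I. f i x = 0) \<Longrightarrow> g x - k * f a x = 0"
  proof (cases "\<exists>e. (\<forall>i\<in>I. f i e = 0) \<and> f a e \<noteq> 0")
    case True
    then obtain e where e: "\<forall>i\<in>I. f i e = 0" "f a e \<noteq> 0" by blast
    have "g x - (g e / f a e) * f a x = 0" if x: "\<forall>i\<in>I. f i x = 0" for x
    proof -
      let ?y = "x - (f a x / f a e) *\<^sub>R e"
      have "f i ?y = 0" if "i \<in> insert a I" for i
        using that x e lin[OF that] by (auto simp: linear_diff linear_scale)
      then have "g ?y = 0"
        using insert.prems(3) by blast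
      then show ?thesis
        using insert.prems(2) by (simp add: linear_diff linear_scale)
    qed
    then show thesis by (rule that)
  next
    case False
    then have "g x - 0 * f a x = 0" if "\<forall>i\<in>I. f i x = 0" for x
      using insert.prems(3)[of x] that by auto
    then show thesis by (rule that)
  qed
  have "linear (\<lambda>x. g x - k * f a x)"
    using insert.prems(2) lin[of a]
    by (intro linear_compose_sub) (auto intro: linear_compose_scale_right[where 'b = real, simplified])
  then obtain c where c: "\<And>x. g x - k * f a x = (\<Sum>i\<in>I. c i * f i x)"
    using insert.IH[of "\<lambda>x. g x - k * f a x"] lin k by auto
  have "g x = (\<Sum>i\<in>insert a I. (c(a := k)) i * f i x)" for x
  proof -
    have "(\<Sum>i\<in>I. (c(a := k)) i * f i x) = (\<Sum>i\<in>I. c i * f i x)"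
      using insert.hyps by (intro sum.cong) auto
    then show ?thesis
      using insert.hyps c[of x] by simp
  qed
  then show ?case by blast
qed

lemma independent_Un_linear_image:
  assumes "linear L" "subspace R" "span B = R" "independent B" "finite B"
    and "finite C" "independent C" "\<And>x. x \<in> span C \<Longrightarrow> L x \<in> R \<Longrightarrow> x = 0"
  shows "independent (B \<union> L ` C) \<and> card (B \<union> L ` C) = card B + card C"
  using assms(6-8)
proof (induction C rule: finite_induct)
  case empty
  then show ?case using assms by simp
next
  case (insert c C)
  have "c \<notin> span C" "independent C"
    using insert by (auto simp: independent_insert)
  have IH: "independent (B \<union> L ` C)" "card (B \<union> L ` C) = card B + card C"
    using insert.IH insert.prems(2) \<open>independent C\<close> span_mono[of C "insert c C"] by blast+
  have new: "L c \<notin> span (B \<union> L ` C)"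
  proof
    assume "L c \<in> span (B \<union> L ` C)"
    then obtain b y where bL: "b \<in> R" "y \<in> span C" "L c = b + L y"
      using assms(1,3) by (auto simp: span_Un linear_span_image)
    \<comment> \<open>A dependence would place the nonzero vector \<open>c - y\<close> of the larger
      span in the preimage of \<open>R\<close>.\<close>
    have "L (c - y) \<in> R"
      using bL assms(1) by (simp add: linear_diff)
    moreover have "c - y \<in> span (insert c C)"
      using subsetD[OF span_mono[OF subset_insertI] bL(2)] by (simp add: span_base span_diff)
    ultimately have "c = y"
      using insert.prems(2)[of "c - y"] by simp
    then show False using bL \<open>c \<notin> span C\<close> by simp
  qed
  then have "L c \<notin> B \<union> L ` C"
    using span_superset[of "B \<union> L ` C"] by auto
  then show ?case
    using IH new insert.hyps assms(5) by (simp add: independent_insert)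
qed

lemma edim_mono_infinity:
  assumes "V \<subseteq> W" "edim V = \<infinity>"
  shows "edim W = \<infinity>"
  using assms unfolding edim_def by (auto split: if_splits)

text \<open>By \<open>inj\<close>, a basis of \<open>R\<close> together with the image of a basis of
  \<open>N\<close> is a basis of the sum. If \<open>R\<close> is infinite-dimensional, so is the
  sum, since it contains \<open>R\<close>.\<close>

lemma edim_direct_sum_linear_image:
  fixes L :: "'b::euclidean_space \<Rightarrow> 'a::real_vector"
  assumes "linear L" "subspace R" "subspace N"
    and inj: "\<And>x. x \<in> N \<Longrightarrow> L x \<in> R \<Longrightarrow> x = 0"
  shows "edim {r + L x | r x. r \<in> R \<and> x \<in> N} = edim R + enat (dim N)"
    (is "edim ?W = _")
proof (cases "\<exists>B. finite B \<and> R \<subseteq> span B")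
  case False
  have "R \<subseteq> ?W"
    using assms(1) subspace_0[OF assms(3)] by (force simp: linear_0)
  with False show ?thesis
    using edim_mono_infinity[of R ?W] by (simp add: edim_def)
next
  case True
  then obtain B0 where B0: "finite B0" "R \<subseteq> span B0" by blast
  obtain B where B: "B \<subseteq> R" "independent B" "R \<subseteq> span B" "card B = dim R"
    using basis_exists by blast
  have "finite B"
    using independent_span_bound[OF B0(1) B(2)] B(1) B0(2) by blast
  have spB: "span B = R"
    using B assms(2) by (simp add: span_minimal subset_antisym)
  obtain C where C: "C \<subseteq> N" "independent C" "N \<subseteq> span C" "card C = dim N"
    using basis_exists by blast
  have spC: "span C = N"
    using C assms(3) by (simp add: span_minimal subset_antisym)
  have "finite C"
    using C(2) by (rule independent_imp_finite)
  let ?D = "B \<union> L ` C"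
  have D: "independent ?D" "card ?D = card B + card C"
    using independent_Un_linear_image[of L R B C] assms spB B \<open>finite B\<close> \<open>finite C\<close> C(2) spC
    by blast+
  have W: "?W = span ?D"
    using spB spC assms(1) by (auto simp: span_Un linear_span_image)
  have "dim ?W = dim R + dim N"
    unfolding W using D B(4) C(4) by (simp add: dim_eq_card_independent)
  moreover have "\<exists>B. finite B \<and> ?W \<subseteq> span B"
    using W \<open>finite B\<close> \<open>finite C\<close> by (intro exI[of _ ?D]) auto
  ultimately show ?thesis
    using True by (simp add: edim_def)
qed

theorem theorem1p5:
  fixes S :: "'a::{real_inner, complete_space} \<Rightarrow> 'a \<Rightarrow> real"
    and u :: "'n::finite \<Rightarrow> 'a"
    and \<phi> :: "'n \<Rightarrow> ('a \<Rightarrow>\<^sub>L real)"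
  assumes "separable_space (euclidean :: 'a topology)"
    and "continuous_symmetric_bilinear_form S"
    and "\<And>i. induced_map S (u i) = \<phi> i"
    and "inj \<phi>" and "independent (range \<phi>)"
  shows "nullity_on S (\<Inter>i. Ker (\<phi> i)) =
         nullity_on S UNIV +
         enat (dim {x :: real^'n. (\<chi> i j. S (u i) (u j)) *v x = 0})"
proof -
  define A :: "real^'n^'n" where "A = (\<chi> i j. S (u i) (u j))"
  define N where "N = {x. A *v x = 0}"
  define K where "K = (\<Inter>i. Ker (\<phi> i))"
  define R where "R = radical_on S UNIV"
  define L where "L x = (\<Sum>i\<in>UNIV. x $ i *\<^sub>R u i)" for x :: "real^'n"
  have bil: "bilinear S" and sym: "S v w = S w v" for v w
    using assms(2) by (auto simp: continuous_symmetric_bilinear_form_def)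
  have linS: "linear (S v)" for v
    using bil by (simp add: bilinear_def)
  have phi: "blinfun_apply (\<phi> i) v = S (u i) v" for i v
    using induced_map_apply[OF assms(2), of "u i" v] assms(3) by simp
  have memK: "v \<in> K \<longleftrightarrow> (\<forall>i. S (u i) v = 0)" for v
    by (simp add: K_def Ker_def phi)
  have memR: "v \<in> R \<longleftrightarrow> (\<forall>w. S v w = 0)" for v
    by (simp add: R_def radical_on_def)
  have linL: "linear L"
    by (rule linearI) (simp_all add: L_def scaleR_add_left sum.distrib scaleR_sum_right)
  have SL: "S (L x) w = (\<Sum>i\<in>UNIV. x $ i * S (u i) w)" for x w
    unfolding sym[of _ w] L_def using linS by (simp add: linear_sum linear_scale)
  have subR: "subspace R"
    using bil
    by (intro subspaceI) (simp_all add: memR bilinear_lzero bilinear_ladd bilinear_lmul)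
  have subN: "subspace N"
    unfolding N_def subspace_def
    by (auto simp: matrix_vector_right_distrib matrix_vector_mult_scaleR)
  \<comment> \<open>The entries of \<open>A *v x\<close> are the values of the
    \<open>\<phi> i\<close> at \<open>L x\<close>, by symmetry of \<open>S\<close>.\<close>
  have memN: "x \<in> N \<longleftrightarrow> L x \<in> K" for x
  proof -
    have "(A *v x) $ i = S (u i) (L x)" for i
      unfolding sym[of "u i"] SL
      by (simp add: A_def matrix_vector_mult_def mult.commute sym[of "u i"])
    then show ?thesis by (simp add: N_def memK vec_eq_iff)
  qed
  have inj: "x = 0" if "L x \<in> R" for x
  proof -
    have "(\<Sum>i\<in>UNIV. x $ i *\<^sub>R \<phi> i) = 0"
      using that by (intro blinfun_eqI) (simp add: blinfun.sum_left blinfun.scaleR_left phi memR SL)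
    \<comment> \<open>Independence concerns the set \<open>range \<phi>\<close>; injectivity of
      \<open>\<phi>\<close> lets the coefficients be indexed by its elements.\<close>
    then have "(\<Sum>v\<in>range \<phi>. (x $ inv \<phi> v) *\<^sub>R v) = 0"
      using assms(4) by (simp add: sum.reindex)
    then have "x $ inv \<phi> (\<phi> i) = 0" for i
      by (intro independentD[OF assms(5), of "range \<phi>"]) auto
    then show ?thesis
      using assms(4) by (simp add: vec_eq_iff)
  qed
  have "radical_on S K = {r + L x | r x. r \<in> R \<and> x \<in> N}" (is "_ = ?W")
  proof (intro subset_antisym subsetI)
    fix w assume "w \<in> radical_on S K"
    then have w: "w \<in> K" "\<And>v. v \<in> K \<Longrightarrow> S w v = 0"
      by (auto simp: radical_on_def)
    obtain c where c: "\<And>v. S w v = (\<Sum>i\<in>UNIV. c i * S (u i) v)"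
      using linear_functional_combination[of UNIV "\<lambda>i. S (u i)" "S w"] linS w(2) memK by auto
    define x where "x = (\<chi> i. c i)"
    have r: "w - L x \<in> R"
      using bil by (simp add: memR bilinear_lsub SL c x_def)
    \<comment> \<open>Hence \<open>w\<close> and \<open>L x\<close> have the same values under every
      \<open>\<phi> i\<close>, and \<open>w \<in> K\<close> passes to \<open>L x\<close>.\<close>
    have "S (u i) (w - L x) = 0" for i
      using r by (simp add: memR sym[of "u i"])
    then have "x \<in> N"
      using w(1) linS by (simp add: memN memK linear_diff)
    moreover have "w = (w - L x) + L x" by simp
    ultimately show "w \<in> ?W" using r by blast
  next
    fix w assume "w \<in> ?W"
    then obtain r x where w: "w = r + L x" and r: "r \<in> R" and x: "x \<in> N" by blast
    have "r \<in> K"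
      using r by (simp add: memK memR sym[of _ r])
    then have "w \<in> K"
      using x linS by (simp add: w memN memK linear_add)
    \<comment> \<open>The \<open>r\<close> part contributes nothing, and \<open>S (L x)\<close> is a
      combination of the \<open>\<phi> i\<close>, all zero on \<open>K\<close>.\<close>
    moreover have "S w v = 0" if "v \<in> K" for v
      using that r bil by (simp add: w bilinear_ladd SL memK memR)
    ultimately show "w \<in> radical_on S K"
      by (simp add: radical_on_def)
  qed
  then have "edim (radical_on S K) = edim R + enat (dim N)"
    using edim_direct_sum_linear_image[OF linL subR subN] inj by simp
  then show ?thesis
    by (simp add: nullity_on_def K_def R_def N_def A_def)
qed

end
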